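(* For the following triplets $(e,\tau_0,\tau_1)$, the maximal entries of every level of the TRIP-Stern tree lie on the indicated path; that is, for every $n\ge0$, $m_n$ equals the largest entry of $\triangle(w_n)$, where $w_n$ is the length-$n$ prefix of the indicated infinite $0$-$1$ word: (1) For $(e,e,13)$, $(e,13,13)$, $(e,13,123)$, $(e,23,13)$, $(e,23,123)$, $(e,23,132)$, $(e,123,13)$, $(e,123,123)$, $(e,132,13)$, $(e,132,123)$, $(e,132,132)$: always select the right edge, i.e. $w=111\cdots$, so $\triangle(w_n)=(1,1,1)F_1^n$. (2) For $(e,e,e)$, $(e,e,12)$, $(e,e,23)$, $(e,e,123)$, $(e,e,132)$, $(e,12,e)$, $(e,12,12)$, $(e,12,13)$, $(e,12,23)$, $(e,12,123)$, $(e,12,132)$, $(e,132,23)$: always select the left edge, i.e. $w=000\cdots$, so $\triangle(w_n)=(1,1,1)F_0^n$. (3) For $(e,13,12)$, $(e,23,23)$, $(e,123,e)$: alternate, first selecting the left edge and then the right edge, i.e. $w=0101\cdots$.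
   Context: Let $A_0=\begin{pmatrix}0&0&1\\1&0&0\\0&1&1\end{pmatrix}$, $A_1=\begin{pmatrix}1&0&1\\0&1&0\\0&0&1\end{pmatrix}$. Elements of $S_3$ are identified with permutation matrices: $e=I$, $(12)=\begin{pmatrix}0&1&0\\1&0&0\\0&0&1\end{pmatrix}$, $(13)=\begin{pmatrix}0&0&1\\0&1&0\\1&0&0\end{pmatrix}$, $(23)=\begin{pmatrix}1&0&0\\0&0&1\\0&1&0\end{pmatrix}$, $(123)=\begin{pmatrix}0&1&0\\0&0&1\\1&0&0\end{pmatrix}$, $(132)=\begin{pmatrix}0&0&1\\1&0&0\\0&1&0\end{pmatrix}$. For $(\sigma,\tau_0,\tau_1)\in S_3^3$ put $F_0=\sigma A_0\tau_0$, $F_1=\sigma A_1\tau_1$. For $v=(i_1,\dots,i_n)\in\{0,1\}^n$ let $\triangle(v)=(1,1,1)F_{i_1}\cdots F_{i_n}=(b_1(v),b_2(v),b_3(v))$; the TRIP-Stern tree is the binary tree with root $(1,1,1)$ in which the left child of a node $x$ is $xF_0$ and the right child is $xF_1$, so level $n$ consists of the $\triangle(v)$ with $|v|=n$. The maximal entry of level $n$ is $m_n=\max_{|v|=n}\max_i b_i(v)$. *)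

theory Defs
  imports "HOL-Analysis.Analysis"
begin

type_synonym mat3 = "int ^ 3 ^ 3"

definition A0 :: mat3 where
  "A0 = vector [vector [0, 0, 1], vector [1, 0, 0], vector [0, 1, 1]]"

definition A1 :: mat3 where
  "A1 = vector [vector [1, 0, 1], vector [0, 1, 0], vector [0, 0, 1]]"

text \<open>Elements of the symmetric group on three letters, identified with permutation matrices.
  Only these explicit matrices fix the convention (rows versus columns, order of composition).\<close>

definition p_e :: mat3 where
  "p_e = mat 1"

definition p_12 :: mat3 where
  "p_12 = vector [vector [0, 1, 0], vector [1, 0, 0], vector [0, 0, 1]]"

definition p_13 :: mat3 where
  "p_13 = vector [vector [0, 0, 1], vector [0, 1, 0], vector [1, 0, 0]]"

definition p_23 :: mat3 where
  "p_23 = vector [vector [1, 0, 0], vector [0, 0, 1], vector [0, 1, 0]]"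

definition p_123 :: mat3 where
  "p_123 = vector [vector [0, 1, 0], vector [0, 0, 1], vector [1, 0, 0]]"

definition p_132 :: mat3 where
  "p_132 = vector [vector [0, 0, 1], vector [1, 0, 0], vector [0, 1, 0]]"

text \<open>A triplet \<open>(\<sigma>, \<tau>\<^sub>0, \<tau>\<^sub>1)\<close>. The index \<open>i\<close> of \<open>F\<close> is
  only meant to be \<open>0\<close> (left edge) or \<open>1\<close> (right edge).\<close>

type_synonym triplet = "mat3 \<times> mat3 \<times> mat3"

fun F :: "triplet \<Rightarrow> nat \<Rightarrow> mat3" where
  "F (\<sigma>, \<tau>0, \<tau>1) i = (if i = 0 then \<sigma> ** A0 ** \<tau>0 else \<sigma> ** A1 ** \<tau>1)"

definition triangle :: "triplet \<Rightarrow> nat list \<Rightarrow> int ^ 3" where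
  "triangle t v = vector [1, 1, 1] v* foldr (\<lambda>i M. F t i ** M) v (mat 1)"

definition level_words :: "nat \<Rightarrow> nat list set" where
  "level_words n = {v. length v = n \<and> set v \<subseteq> {0, 1}}"

definition max_entry :: "int ^ 3 \<Rightarrow> int" where
  "max_entry x = Max (range (\<lambda>i. x $ i))"

definition level_max :: "triplet \<Rightarrow> nat \<Rightarrow> int" where
  "level_max t n = Max ((\<lambda>v. max_entry (triangle t v)) ` level_words n)"

definition word_prefix :: "(nat \<Rightarrow> nat) \<Rightarrow> nat \<Rightarrow> nat list" where
  "word_prefix w n = map w [0..<n]"

definition maximal_along :: "triplet \<Rightarrow> (nat \<Rightarrow> nat) \<Rightarrow> bool" where
  "maximal_along t w \<longleftrightarrow> (\<forall>n. level_max t n = max_entry (triangle t (word_prefix w n)))"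

text \<open>The product formula for \<open>triangle\<close> describes the tree: the root is \<open>(1, 1, 1)\<close> and the
  children of a node are obtained by multiplying it on the right by \<open>F t 0\<close> and \<open>F t 1\<close>.\<close>

lemma triangle_Nil: "triangle t [] = vector [1, 1, 1]"
  by (simp add: triangle_def)

lemma triangle_snoc: "triangle t (v @ [i]) = triangle t v v* F t i"
proof -
  have "foldr (\<lambda>i M. F t i ** M) v N = foldr (\<lambda>i M. F t i ** M) v (mat 1) ** N" for N
    by (induction v) (simp_all add: matrix_mul_assoc)
  from this[of "F t i"] show ?thesis
    by (simp add: triangle_def vector_matrix_mul_assoc)
qed

lemma finite_level_words: "finite (level_words n)"
  using finite_lists_length_eq[of "{0, 1::nat}" n] by (simp add: level_words_def conj_commute)

lemma level_words_nonempty: "level_words n \<noteq> {}"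
proof -
  have "replicate n 0 \<in> level_words n"
    by (auto simp: level_words_def)
  then show ?thesis by blast
qed

end

theory Submission
  imports Defs
begin

text \<open>Every node lies below a numerical sequence \<open>p\<^sub>n\<close> that the indicated path attains. A child
  of \<open>(a, b, c)\<close> consists of \<open>a + c\<close>, \<open>b\<close> and one of \<open>a\<close>, \<open>c\<close>, in an order given by the
  permutations, so the growth depends on where the large entries are put. In the worst case the
  two largest ones are added up in each step (\<open>p\<^sub>n\<^sub>+\<^sub>1 = p\<^sub>n + p\<^sub>n\<^sub>-\<^sub>1\<close>); otherwise the sequence satisfies
  \<open>p\<^sub>n\<^sub>+\<^sub>1 = p\<^sub>n + p\<^sub>n\<^sub>-\<^sub>2\<close> or \<open>p\<^sub>n\<^sub>+\<^sub>1 = p\<^sub>n\<^sub>-\<^sub>1 + p\<^sub>n\<^sub>-\<^sub>2\<close>. In each of the three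
  cases, finitely many linear bounds on sums of entries of a node, in terms of consecutive members
  of the sequence, are inherited by both children.\<close>

lemma vec3_eq_iff: "x = y \<longleftrightarrow> x $ 1 = y $ 1 \<and> x $ 2 = y $ 2 \<and> x $ 3 = y $ 3"
  for x y :: "'a ^ 3"
  by (simp add: vec_eq_iff forall_3)

lemma vector_matrix_mult_A0:
  "(x v* A0) $ 1 = x $ 2" "(x v* A0) $ 2 = x $ 3" "(x v* A0) $ 3 = x $ 1 + x $ 3"
  by (simp_all add: A0_def vector_matrix_mult_def sum_3)

lemma vector_matrix_mult_A1:
  "(x v* A1) $ 1 = x $ 1" "(x v* A1) $ 2 = x $ 2" "(x v* A1) $ 3 = x $ 1 + x $ 3"
  by (simp_all add: A1_def vector_matrix_mult_def sum_3)

lemma vector_matrix_mult_perm: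
  "(x v* p_12) $ 1 = x $ 2" "(x v* p_12) $ 2 = x $ 1" "(x v* p_12) $ 3 = x $ 3"
  "(x v* p_13) $ 1 = x $ 3" "(x v* p_13) $ 2 = x $ 2" "(x v* p_13) $ 3 = x $ 1"
  "(x v* p_23) $ 1 = x $ 1" "(x v* p_23) $ 2 = x $ 3" "(x v* p_23) $ 3 = x $ 2"
  "(x v* p_123) $ 1 = x $ 3" "(x v* p_123) $ 2 = x $ 1" "(x v* p_123) $ 3 = x $ 2"
  "(x v* p_132) $ 1 = x $ 2" "(x v* p_132) $ 2 = x $ 3" "(x v* p_132) $ 3 = x $ 1"
  by (simp_all add: p_12_def p_13_def p_23_def p_123_def p_132_def
      vector_matrix_mult_def sum_3)

lemma vector_matrix_mult_p_e: "x v* p_e = x"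
  by (simp add: p_e_def)

lemma vector_matrix_mult_F:
  "x v* F (p_e, \<tau>0, \<tau>1) i = (if i = 0 then x v* A0 v* \<tau>0 else x v* A1 v* \<tau>1)"
  by (simp add: p_e_def vector_matrix_mul_assoc)

lemmas step_simps = vector_matrix_mult_F vector_matrix_mult_A0 vector_matrix_mult_A1
  vector_matrix_mult_perm vector_matrix_mult_p_e

declare F.simps [simp del]

lemma max_entry_le_iff: "max_entry x \<le> m \<longleftrightarrow> (\<forall>i. x $ i \<le> m)"
  by (auto simp: max_entry_def)

lemma entry_le_max_entry: "x $ i \<le> max_entry x"
  by (simp add: max_entry_def)

lemma word_prefix_Suc: "word_prefix w (Suc n) = word_prefix w n @ [w n]"
  by (simp add: word_prefix_def)

lemma word_prefix_in_level_words:
  assumes "range w \<subseteq> {0, 1}"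
  shows "word_prefix w n \<in> level_words n"
  using assms by (auto simp: word_prefix_def level_words_def image_subset_iff)

text \<open>The state \<open>(nxt ^^ n) s\<close> records the recent members of the bounding sequence, the first
  being the bound for level \<open>n\<close>; \<open>G\<close> arranges a state to the node of the path, depending on the parity of
  the level.\<close>

lemma maximal_alongI:
  fixes R :: "int \<times> int \<times> int \<Rightarrow> int ^ 3 \<Rightarrow> bool"
    and nxt :: "int \<times> int \<times> int \<Rightarrow> int \<times> int \<times> int"
    and G :: "bool \<Rightarrow> int \<times> int \<times> int \<Rightarrow> int ^ 3"
  assumes root: "R s (vector [1, 1, 1])"
    and step: "\<And>s x i. R s x \<Longrightarrow> i \<in> {0, 1} \<Longrightarrow> R (nxt s) (x v* F t i)"
    and bound: "\<And>s x. R s x \<Longrightarrow> x $ 1 \<le> fst s \<and> x $ 2 \<le> fst s \<and> x $ 3 \<le> fst s"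
    and word: "range w \<subseteq> {0, 1}"
    and path_root: "G True s = vector [1, 1, 1]"
    and path_step: "\<And>s k. G (even k) s v* F t (w k) = G (odd k) (nxt s)"
    and attained: "\<And>s b. fst s \<in> {G b s $ 1, G b s $ 2, G b s $ 3}"
  shows "maximal_along t w"
  unfolding maximal_along_def
proof
  fix n
  have R: "R ((nxt ^^ length v) s) (triangle t v)" if "set v \<subseteq> {0, 1}" for v
    using that by (induction v rule: rev_induct) (simp_all add: triangle_Nil triangle_snoc root step)
  have le: "max_entry (triangle t v) \<le> fst ((nxt ^^ n) s)" if "v \<in> level_words n" for v
    using bound[OF R[of v]] that by (auto simp: level_words_def max_entry_le_iff forall_3)
  have "triangle t (word_prefix w n) = G (even n) ((nxt ^^ n) s)"
  proof (induction n)
    case 0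
    show ?case by (simp add: word_prefix_def triangle_Nil path_root)
  next
    case (Suc n)
    then show ?case by (simp add: word_prefix_Suc triangle_snoc path_step)
  qed
  then have ge: "fst ((nxt ^^ n) s) \<le> max_entry (triangle t (word_prefix w n))"
    using attained[of "(nxt ^^ n) s" "even n"] entry_le_max_entry[of "G (even n) ((nxt ^^ n) s)"]
    by auto
  show "level_max t n = max_entry (triangle t (word_prefix w n))"
    unfolding level_max_def
  proof (rule Max_eqI)
    show "finite ((\<lambda>v. max_entry (triangle t v)) ` level_words n)"
      by (simp add: finite_level_words)
  next
    fix y assume "y \<in> (\<lambda>v. max_entry (triangle t v)) ` level_words n"
    then show "y \<le> max_entry (triangle t (word_prefix w n))"
      using le ge by fastforce
  next
    show "max_entry (triangle t (word_prefix w n)) \<in> (\<lambda>v. max_entry (triangle t v)) ` level_words n"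
      using word_prefix_in_level_words[OF word] by blast
  qed
qed

subsection \<open>Growth \<open>p\<^sub>n\<^sub>+\<^sub>1 = p\<^sub>n + p\<^sub>n\<^sub>-\<^sub>1\<close>\<close>

text \<open>The third component is constant: it is the middle entry \<open>1\<close> of the nodes on the path.\<close>

definition fib_next :: "int \<times> int \<times> int \<Rightarrow> int \<times> int \<times> int" where
  "fib_next = (\<lambda>(p, q, r). (p + q, p, r))"

text \<open>Symmetric in the entries, so every choice of \<open>\<tau>0\<close> and
  \<open>\<tau>1\<close> preserves it; the triplet only decides which path attains it.\<close>

definition fib_bound :: "int \<times> int \<times> int \<Rightarrow> int ^ 3 \<Rightarrow> bool" where
  "fib_bound = (\<lambda>(p, q, r) x. 0 \<le> q \<and> q \<le> p \<and> x $ 1 \<le> p \<and> x $ 2 \<le> p \<and> x $ 3 \<le> p \<and>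
    x $ 1 + x $ 2 \<le> p + q \<and> x $ 1 + x $ 3 \<le> p + q \<and> x $ 2 + x $ 3 \<le> p + q)"

lemma maximal_along_fib_right:
  assumes "t \<in> {(p_e, p_e, p_13), (p_e, p_13, p_13), (p_e, p_23, p_13),
    (p_e, p_123, p_13), (p_e, p_132, p_13)}"
  shows "maximal_along t (\<lambda>k. 1)"
  by (rule maximal_alongI[where R = "fib_bound" and s = "(1, 1, 1)" and nxt = fib_next
      and G = "\<lambda>_ (p, q, r). vector [p, r, q]"])
    (use assms in \<open>auto simp: step_simps fib_bound_def vec3_eq_iff fib_next_def\<close>)

lemma maximal_along_fib_left:
  assumes "t \<in> {(p_e, p_12, p_e), (p_e, p_12, p_12), (p_e, p_12, p_13),
    (p_e, p_12, p_23), (p_e, p_12, p_123), (p_e, p_12, p_132)}"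
  shows "maximal_along t (\<lambda>k. 0)"
  by (rule maximal_alongI[where R = "fib_bound" and s = "(1, 1, 1)" and nxt = fib_next
      and G = "\<lambda>_ (p, q, r). vector [q, r, p]"])
    (use assms in \<open>auto simp: step_simps fib_bound_def vec3_eq_iff fib_next_def\<close>)

text \<open>The left edge keeps \<open>c\<close> and puts \<open>a + c\<close> first, the right edge
  keeps \<open>a\<close> and puts \<open>a + c\<close> last: the largest entry changes ends, and the
  edge keeping it alternates.\<close>

lemma maximal_along_fib_alternating: "maximal_along (p_e, p_123, p_e) (\<lambda>k. k mod 2)"
  by (rule maximal_alongI[where R = "fib_bound" and s = "(1, 1, 1)" and nxt = fib_next
      and G = "\<lambda>b (p, q, r). if b then vector [q, r, p] else vector [p, r, q]"])
    (auto simp: step_simps fib_bound_def vec3_eq_iff fib_next_def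
        mod_2_eq_odd split: if_splits)

subsection \<open>Growth \<open>p\<^sub>n\<^sub>+\<^sub>1 = p\<^sub>n + p\<^sub>n\<^sub>-\<^sub>2\<close>\<close>

definition narayana_next :: "int \<times> int \<times> int \<Rightarrow> int \<times> int \<times> int" where
  "narayana_next = (\<lambda>(p, q, r). (p + r, p, q))"

text \<open>The sum of the ends becomes an entry, hence its sharper bound. This is inherited when
  the old middle entry moves to an end: the new ends then sum to at most
  \<open>p + q + r\<close>.\<close>

definition narayana_bound :: "int \<times> int \<times> int \<Rightarrow> int ^ 3 \<Rightarrow> bool" where
  "narayana_bound = (\<lambda>(p, q, r) x. 0 \<le> r \<and> r \<le> q \<and> q \<le> p \<and>
    x $ 1 \<le> p \<and> x $ 2 \<le> p \<and> x $ 3 \<le> p \<and> x $ 1 + x $ 3 \<le> p + r \<and>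
    x $ 1 + x $ 2 \<le> p + q \<and> x $ 2 + x $ 3 \<le> p + q \<and> x $ 1 + x $ 2 + x $ 3 \<le> p + q + r)"

lemma maximal_along_narayana_right:
  assumes "t \<in> {(p_e, p_13, p_123), (p_e, p_23, p_123), (p_e, p_132, p_123)}"
  shows "maximal_along t (\<lambda>k. 1)"
  by (rule maximal_alongI[where R = "narayana_bound" and s = "(1, 1, 1)" and nxt = narayana_next
      and G = "\<lambda>_ (p, q, r). vector [p, q, r]"])
    (use assms in \<open>auto simp: step_simps narayana_bound_def vec3_eq_iff narayana_next_def\<close>)

lemma maximal_along_narayana_left:
  assumes "t \<in> {(p_e, p_e, p_12), (p_e, p_e, p_23), (p_e, p_e, p_123), (p_e, p_e, p_132)}"
  shows "maximal_along t (\<lambda>k. 0)"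
  by (rule maximal_alongI[where R = "narayana_bound" and s = "(1, 1, 1)" and nxt = narayana_next
      and G = "\<lambda>_ (p, q, r). vector [r, q, p]"])
    (use assms in \<open>auto simp: step_simps narayana_bound_def vec3_eq_iff narayana_next_def\<close>)

lemma maximal_along_narayana_alternating: "maximal_along (p_e, p_13, p_12) (\<lambda>k. k mod 2)"
  by (rule maximal_alongI[where R = "narayana_bound" and s = "(1, 1, 1)" and nxt = narayana_next
      and G = "\<lambda>b (p, q, r). if b then vector [r, q, p] else vector [p, q, r]"])
    (auto simp: step_simps narayana_bound_def vec3_eq_iff narayana_next_def
        mod_2_eq_odd split: if_splits)

text \<open>For the two remaining triplets, the entry kept besides \<open>a + c\<close> and \<open>b\<close> can be put at the
  opposite end of the child. It is then the smallest entry of the parent, as all nodes are monotone.\<close>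

lemma maximal_along_narayana_decreasing: "maximal_along (p_e, p_123, p_123) (\<lambda>k. 1)"
  by (rule maximal_alongI[where R = "\<lambda>s x. narayana_bound s x \<and>
          0 \<le> x $ 3 \<and> x $ 3 \<le> x $ 2 \<and> x $ 2 \<le> x $ 1"
        and s = "(1, 1, 1)" and nxt = narayana_next and G = "\<lambda>_ (p, q, r). vector [p, q, r]"])
    (auto simp: step_simps narayana_bound_def vec3_eq_iff narayana_next_def)

lemma maximal_along_narayana_increasing: "maximal_along (p_e, p_e, p_e) (\<lambda>k. 0)"
  by (rule maximal_alongI[where R = "\<lambda>s x. narayana_bound s x \<and>
          0 \<le> x $ 1 \<and> x $ 1 \<le> x $ 2 \<and> x $ 2 \<le> x $ 3"
        and s = "(1, 1, 1)" and nxt = narayana_next and G = "\<lambda>_ (p, q, r). vector [r, q, p]"])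
    (auto simp: step_simps narayana_bound_def vec3_eq_iff narayana_next_def)

subsection \<open>Growth \<open>p\<^sub>n\<^sub>+\<^sub>1 = p\<^sub>n\<^sub>-\<^sub>1 + p\<^sub>n\<^sub>-\<^sub>2\<close>\<close>

definition padovan_next :: "int \<times> int \<times> int \<Rightarrow> int \<times> int \<times> int" where
  "padovan_next = (\<lambda>(p, q, r). (q + r, p, q))"

text \<open>For the triplets below, both edges put \<open>a + c\<close> in the middle, so the ends
  lag one step behind. The clause \<open>p \<le> q + r\<close> keeps the sequence monotone.\<close>

definition padovan_bound :: "int \<times> int \<times> int \<Rightarrow> int ^ 3 \<Rightarrow> bool" where
  "padovan_bound = (\<lambda>(p, q, r) x. 0 \<le> r \<and> r \<le> q \<and> q \<le> p \<and> p \<le> q + r \<and>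
    x $ 1 \<le> q \<and> x $ 2 \<le> p \<and> x $ 3 \<le> q \<and> x $ 1 + x $ 3 \<le> q + r \<and>
    x $ 1 + x $ 2 \<le> p + q \<and> x $ 2 + x $ 3 \<le> p + q \<and> x $ 1 + x $ 2 + x $ 3 \<le> p + q + r)"

lemma maximal_along_padovan_right:
  assumes "t \<in> {(p_e, p_23, p_132), (p_e, p_132, p_132)}"
  shows "maximal_along t (\<lambda>k. 1)"
  by (rule maximal_alongI[where R = "padovan_bound" and s = "(1, 1, 1)" and nxt = padovan_next
      and G = "\<lambda>_ (p, q, r). vector [q, p, r]"])
    (use assms in \<open>auto simp: step_simps padovan_bound_def vec3_eq_iff padovan_next_def\<close>)

lemma maximal_along_padovan_left: "maximal_along (p_e, p_132, p_23) (\<lambda>k. 0)"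
  by (rule maximal_alongI[where R = "padovan_bound" and s = "(1, 1, 1)" and nxt = padovan_next
      and G = "\<lambda>_ (p, q, r). vector [r, p, q]"])
    (auto simp: step_simps padovan_bound_def vec3_eq_iff padovan_next_def)

lemma maximal_along_padovan_alternating: "maximal_along (p_e, p_23, p_23) (\<lambda>k. k mod 2)"
  by (rule maximal_alongI[where R = "padovan_bound" and s = "(1, 1, 1)" and nxt = padovan_next
      and G = "\<lambda>b (p, q, r). if b then vector [r, p, q] else vector [q, p, r]"])
    (auto simp: step_simps padovan_bound_def vec3_eq_iff padovan_next_def
        mod_2_eq_odd split: if_splits)

theorem theorem10:
  shows "(\<forall>t \<in> {(p_e, p_e, p_13), (p_e, p_13, p_13), (p_e, p_13, p_123), (p_e, p_23, p_13),
              (p_e, p_23, p_123), (p_e, p_23, p_132), (p_e, p_123, p_13), (p_e, p_123, p_123),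
              (p_e, p_132, p_13), (p_e, p_132, p_123), (p_e, p_132, p_132)}.
            maximal_along t (\<lambda>k. 1)) \<and>
         (\<forall>t \<in> {(p_e, p_e, p_e), (p_e, p_e, p_12), (p_e, p_e, p_23), (p_e, p_e, p_123),
              (p_e, p_e, p_132), (p_e, p_12, p_e), (p_e, p_12, p_12), (p_e, p_12, p_13),
              (p_e, p_12, p_23), (p_e, p_12, p_123), (p_e, p_12, p_132), (p_e, p_132, p_23)}.
            maximal_along t (\<lambda>k. 0)) \<and>
         (\<forall>t \<in> {(p_e, p_13, p_12), (p_e, p_23, p_23), (p_e, p_123, p_e)}.
            maximal_along t (\<lambda>k. k mod 2))"
  by (simp del: One_nat_def add: maximal_along_fib_right maximal_along_fib_left
      maximal_along_fib_alternating
      maximal_along_narayana_right maximal_along_narayana_left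
      maximal_along_narayana_alternating maximal_along_narayana_decreasing
      maximal_along_narayana_increasing maximal_along_padovan_right
      maximal_along_padovan_left maximal_along_padovan_alternating)

end
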